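(* The variety of Łukasiewicz near semirings is arithmetical (that is, every Łukasiewicz near semiring is both congruence permutable and congruence distributive), with witness Mal'cev term $$p(x,y,z)=\alpha\Big(\big(\alpha(x\cdot\alpha(y))\cdot\alpha(z)\big)+\big(\alpha(z\cdot\alpha(y))\cdot\alpha(x)\big)\Big).$$
   Context: A near semiring is an algebra $\langle R,+,\cdot,0,1\rangle$ such that: (i) $\langle R,+,0\rangle$ is a commutative monoid; (ii) $x\cdot 1=x=1\cdot x$ (multiplication need not be associative or commutative); (iii) $(x+y)\cdot z=(x\cdot z)+(y\cdot z)$; (iv) $x\cdot 0=0\cdot x=0$. It is idempotent if $x+x=x$; then $x\le y$ iff $x+y=y$ defines a partial order, called the induced order. An involutive near semiring is an idempotent near semiring with a map $\alpha:R\to R$ such that $\alpha(\alpha(x))=x$, and $x\le y$ implies $\alpha(y)\le\alpha(x)$. A Łukasiewicz near semiring is an involutive near semiring satisfying the identity $\alpha(x\cdot\alpha(y))\cdot\alpha(y)=\alpha(y\cdot\alpha(x))\cdot\alpha(x)$. An algebra is congruence permutable if $\theta\circ\phi=\phi\circ\theta$ for all its congruences $\theta,\phi$; it is congruence distributive if its lattice of congruences is distributive; it is arithmetical if it is both. A variety is arithmetical if all its members are. A Mal'cev term for a variety is a ternary term $p$ such that $p(x,x,y)=y$ and $p(x,y,y)=x$ hold in the variety. Congruences are with respect to all operations $+,\cdot,\alpha,0,1$. *)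

theory Defs
  imports "HOL-Algebra.Ring" "HOL-Algebra.Lattice"
begin

section \<open>Near semirings\<close>

text \<open>
  Multiplication is neither associative nor commutative and distributes over addition only from
  the right, so of the library's hierarchy only \<open>abelian_monoid\<close> (the additive reduct) is reused.
\<close>

locale near_semiring = abelian_monoid R for R (structure) +
  assumes m_closed: "x \<in> carrier R \<Longrightarrow> y \<in> carrier R \<Longrightarrow> x \<otimes> y \<in> carrier R"
    and one_closed: "\<one> \<in> carrier R"
    and l_one: "x \<in> carrier R \<Longrightarrow> \<one> \<otimes> x = x"
    and r_one: "x \<in> carrier R \<Longrightarrow> x \<otimes> \<one> = x"
    and l_distr: "x \<in> carrier R \<Longrightarrow> y \<in> carrier R \<Longrightarrow> z \<in> carrier R
      \<Longrightarrow> (x \<oplus> y) \<otimes> z = (x \<otimes> z) \<oplus> (y \<otimes> z)"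
    and l_null: "x \<in> carrier R \<Longrightarrow> \<zero> \<otimes> x = \<zero>"
    and r_null: "x \<in> carrier R \<Longrightarrow> x \<otimes> \<zero> = \<zero>"

locale idempotent_near_semiring = near_semiring +
  assumes add_idem: "x \<in> carrier R \<Longrightarrow> x \<oplus> x = x"

definition induced_le :: "('a, 'm) ring_scheme \<Rightarrow> 'a \<Rightarrow> 'a \<Rightarrow> bool"
  where "induced_le R x y \<longleftrightarrow> x \<oplus>\<^bsub>R\<^esub> y = y"

record 'a involutive_algebra = "'a ring" +
  invol :: "'a \<Rightarrow> 'a"  (\<open>\<alpha>\<index>\<close>)

locale involutive_near_semiring = idempotent_near_semiring R for R (structure) +
  assumes invol_closed: "x \<in> carrier R \<Longrightarrow> \<alpha> x \<in> carrier R"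
    and invol_invol: "x \<in> carrier R \<Longrightarrow> \<alpha> (\<alpha> x) = x"
    and invol_antimono: "x \<in> carrier R \<Longrightarrow> y \<in> carrier R \<Longrightarrow> induced_le R x y
      \<Longrightarrow> induced_le R (\<alpha> y) (\<alpha> x)"

locale lukasiewicz_near_semiring = involutive_near_semiring +
  assumes lukasiewicz: "x \<in> carrier R \<Longrightarrow> y \<in> carrier R
    \<Longrightarrow> \<alpha> (x \<otimes> \<alpha> y) \<otimes> \<alpha> y = \<alpha> (y \<otimes> \<alpha> x) \<otimes> \<alpha> x"


section \<open>Congruences\<close>

text \<open>Compatibility with the constants \<open>\<zero>\<close> and \<open>\<one>\<close> amounts to reflexivity.\<close>

definition congruences :: "('a, 'm) involutive_algebra_scheme \<Rightarrow> ('a \<times> 'a) set set" where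
  "congruences A = {\<theta>. equiv (carrier A) \<theta> \<and>
     (\<forall>x y u v. (x, y) \<in> \<theta> \<and> (u, v) \<in> \<theta> \<longrightarrow>
        (x \<oplus>\<^bsub>A\<^esub> u, y \<oplus>\<^bsub>A\<^esub> v) \<in> \<theta> \<and> (x \<otimes>\<^bsub>A\<^esub> u, y \<otimes>\<^bsub>A\<^esub> v) \<in> \<theta>) \<and>
     (\<forall>x y. (x, y) \<in> \<theta> \<longrightarrow> (\<alpha>\<^bsub>A\<^esub> x, \<alpha>\<^bsub>A\<^esub> y) \<in> \<theta>)}"

definition congruence_lattice :: "('a, 'm) involutive_algebra_scheme \<Rightarrow> ('a \<times> 'a) set gorder"
  where "congruence_lattice A = \<lparr>carrier = congruences A, eq = (=), le = (\<subseteq>)\<rparr>"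

locale distributive_lattice = Lattice.lattice L for L (structure) +
  assumes meet_join_distrib: "x \<in> carrier L \<Longrightarrow> y \<in> carrier L \<Longrightarrow> z \<in> carrier L
    \<Longrightarrow> x \<sqinter> (y \<squnion> z) = (x \<sqinter> y) \<squnion> (x \<sqinter> z)"

definition congruence_permutable :: "('a, 'm) involutive_algebra_scheme \<Rightarrow> bool" where
  "congruence_permutable A \<longleftrightarrow>
     (\<forall>\<theta> \<in> congruences A. \<forall>\<phi> \<in> congruences A. \<theta> O \<phi> = \<phi> O \<theta>)"

definition congruence_distributive :: "('a, 'm) involutive_algebra_scheme \<Rightarrow> bool" where
  "congruence_distributive A \<longleftrightarrow> distributive_lattice (congruence_lattice A)"

definition arithmetical :: "('a, 'm) involutive_algebra_scheme \<Rightarrow> bool" where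
  "arithmetical A \<longleftrightarrow> congruence_permutable A \<and> congruence_distributive A"

text \<open>
  A class of algebras is given by its membership predicate; the carriers are arbitrary subsets
  of an arbitrary type \<open>'a\<close>.
\<close>

definition arithmetical_class :: "('a involutive_algebra \<Rightarrow> bool) \<Rightarrow> bool" where
  "arithmetical_class K \<longleftrightarrow> (\<forall>A. K A \<longrightarrow> arithmetical A)"


section \<open>Terms\<close>

datatype 'v trm =
    Var 'v
  | Zero
  | One
  | Plus "'v trm" "'v trm"
  | Times "'v trm" "'v trm"
  | Invol "'v trm"

primrec term_value :: "('a, 'm) involutive_algebra_scheme \<Rightarrow> ('v \<Rightarrow> 'a) \<Rightarrow> 'v trm \<Rightarrow> 'a" where
  "term_value A s (Var v) = s v"
| "term_value A s Zero = \<zero>\<^bsub>A\<^esub>"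
| "term_value A s One = \<one>\<^bsub>A\<^esub>"
| "term_value A s (Plus t u) = term_value A s t \<oplus>\<^bsub>A\<^esub> term_value A s u"
| "term_value A s (Times t u) = term_value A s t \<otimes>\<^bsub>A\<^esub> term_value A s u"
| "term_value A s (Invol t) = \<alpha>\<^bsub>A\<^esub> (term_value A s t)"

datatype var3 = X | Y | Z

definition ternary_operation ::
  "('a, 'm) involutive_algebra_scheme \<Rightarrow> var3 trm \<Rightarrow> 'a \<Rightarrow> 'a \<Rightarrow> 'a \<Rightarrow> 'a" where
  "ternary_operation A p x y z = term_value A (case_var3 x y z) p"

definition malcev_term :: "('a involutive_algebra \<Rightarrow> bool) \<Rightarrow> var3 trm \<Rightarrow> bool" where
  "malcev_term K p \<longleftrightarrow> (\<forall>A. K A \<longrightarrow> (\<forall>x \<in> carrier A. \<forall>y \<in> carrier A.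
     ternary_operation A p x x y = y \<and> ternary_operation A p x y y = x))"

definition lukasiewicz_malcev :: "var3 trm" where
  "lukasiewicz_malcev = Invol (Plus
     (Times (Invol (Times (Var X) (Invol (Var Y)))) (Invol (Var Z)))
     (Times (Invol (Times (Var Z) (Invol (Var Y)))) (Invol (Var X))))"

lemma ternary_operation_lukasiewicz_malcev:
  "ternary_operation A lukasiewicz_malcev x y z =
     \<alpha>\<^bsub>A\<^esub> ((\<alpha>\<^bsub>A\<^esub> (x \<otimes>\<^bsub>A\<^esub> \<alpha>\<^bsub>A\<^esub> y) \<otimes>\<^bsub>A\<^esub> \<alpha>\<^bsub>A\<^esub> z) \<oplus>\<^bsub>A\<^esub> (\<alpha>\<^bsub>A\<^esub> (z \<otimes>\<^bsub>A\<^esub> \<alpha>\<^bsub>A\<^esub> y) \<otimes>\<^bsub>A\<^esub> \<alpha>\<^bsub>A\<^esub> x))"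
  by (simp add: ternary_operation_def lukasiewicz_malcev_def)

end

theory Submission
  imports Defs
begin

text \<open>
  Substituting constants in the Lukasiewicz identity gives \<open>\<alpha> \<zero> = \<one>\<close> and \<open>x \<otimes> \<alpha> x = \<zero>\<close>, so \<open>\<one>\<close> is the
  greatest element and \<open>\<alpha> (x \<otimes> \<alpha> y) \<otimes> \<alpha> y\<close> lies below both \<open>\<alpha> x\<close> and \<open>\<alpha> y\<close>; this yields the Mal'cev
  equations and hence permutability. The induced order is a lattice, \<open>\<alpha>\<close> being an antitone
  involution, so the median is a majority term, and majority terms force distributivity.
\<close>

section \<open>Congruences, their intersections and their composites\<close>

lemma congruences_iff:
  "\<theta> \<in> congruences A \<longleftrightarrow> equiv (carrier A) \<theta> \<and>
     (\<forall>x y u v. (x, y) \<in> \<theta> \<and> (u, v) \<in> \<theta> \<longrightarrow>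
        (x \<oplus>\<^bsub>A\<^esub> u, y \<oplus>\<^bsub>A\<^esub> v) \<in> \<theta> \<and> (x \<otimes>\<^bsub>A\<^esub> u, y \<otimes>\<^bsub>A\<^esub> v) \<in> \<theta>) \<and>
     (\<forall>x y. (x, y) \<in> \<theta> \<longrightarrow> (\<alpha>\<^bsub>A\<^esub> x, \<alpha>\<^bsub>A\<^esub> y) \<in> \<theta>)"
  by (simp add: congruences_def)

context
  fixes A :: "('a, 'm) involutive_algebra_scheme" and \<theta> :: "('a \<times> 'a) set"
  assumes \<theta>: "\<theta> \<in> congruences A"
begin

lemma congruence_equiv: "equiv (carrier A) \<theta>"
  using \<theta> by (simp add: congruences_iff)

lemma congruence_refl: "x \<in> carrier A \<Longrightarrow> (x, x) \<in> \<theta>"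
  using congruence_equiv by (meson equivE refl_onD)

lemma congruence_sym: "(x, y) \<in> \<theta> \<Longrightarrow> (y, x) \<in> \<theta>"
  using congruence_equiv by (meson equivE symD)

lemma congruence_trans: "(x, y) \<in> \<theta> \<Longrightarrow> (y, z) \<in> \<theta> \<Longrightarrow> (x, z) \<in> \<theta>"
  using congruence_equiv by (meson equivE transD)

lemma congruence_carrier: "(x, y) \<in> \<theta> \<Longrightarrow> x \<in> carrier A \<and> y \<in> carrier A"
  using congruence_equiv by (metis equiv_class_eq_iff)

lemma congruence_add: "(x, y) \<in> \<theta> \<Longrightarrow> (u, v) \<in> \<theta> \<Longrightarrow> (x \<oplus>\<^bsub>A\<^esub> u, y \<oplus>\<^bsub>A\<^esub> v) \<in> \<theta>"
  using \<theta> by (simp add: congruences_iff)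

lemma congruence_mult: "(x, y) \<in> \<theta> \<Longrightarrow> (u, v) \<in> \<theta> \<Longrightarrow> (x \<otimes>\<^bsub>A\<^esub> u, y \<otimes>\<^bsub>A\<^esub> v) \<in> \<theta>"
  using \<theta> by (simp add: congruences_iff)

lemma congruence_invol: "(x, y) \<in> \<theta> \<Longrightarrow> (\<alpha>\<^bsub>A\<^esub> x, \<alpha>\<^bsub>A\<^esub> y) \<in> \<theta>"
  using \<theta> by (simp add: congruences_iff)

text \<open>Constants are related to themselves by reflexivity on the carrier, hence the two
  membership hypotheses on an otherwise arbitrary structure.\<close>

lemma congruence_term_value:
  assumes "\<zero>\<^bsub>A\<^esub> \<in> carrier A" "\<one>\<^bsub>A\<^esub> \<in> carrier A" "\<And>v. (s v, s' v) \<in> \<theta>"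
  shows "(term_value A s t, term_value A s' t) \<in> \<theta>"
  using assms
  by (induction t) (auto intro: congruence_refl congruence_add congruence_mult congruence_invol)

lemma congruence_ternary_operation:
  assumes "\<zero>\<^bsub>A\<^esub> \<in> carrier A" "\<one>\<^bsub>A\<^esub> \<in> carrier A"
    and "(x, x') \<in> \<theta>" "(y, y') \<in> \<theta>" "(z, z') \<in> \<theta>"
  shows "(ternary_operation A p x y z, ternary_operation A p x' y' z') \<in> \<theta>"
  unfolding ternary_operation_def using assms
  by (intro congruence_term_value) (auto split: var3.split)

end

lemma equiv_on_iff:
  "equiv A r \<longleftrightarrow> r \<subseteq> A \<times> A \<and> (\<forall>x \<in> A. (x, x) \<in> r) \<and> sym r \<and> trans r"
  by (auto simp: equiv_def refl_on_def)

lemma congruences_Int: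
  assumes "\<theta> \<in> congruences A" "\<phi> \<in> congruences A"
  shows "\<theta> \<inter> \<phi> \<in> congruences A"
proof -
  have "equiv (carrier A) (\<theta> \<inter> \<phi>)"
    using assms[THEN congruence_equiv] by (auto simp: equiv_on_iff intro: sym_Int trans_Int)
  then show ?thesis
    using assms by (auto simp: congruences_iff)
qed

text \<open>Permutability supplies symmetry, because taking converses swaps the two factors, and
  transitivity. Compatibility holds because each operation can also be applied to the intermediate
  elements.\<close>

lemma congruences_relcomp:
  assumes \<theta>: "\<theta> \<in> congruences A" and \<phi>: "\<phi> \<in> congruences A" and perm: "\<theta> O \<phi> = \<phi> O \<theta>"
  shows "\<theta> O \<phi> \<in> congruences A"
proof -
  have "sym (\<theta> O \<phi>)"
    by (rule symI) (use perm congruence_sym[OF \<theta>] congruence_sym[OF \<phi>] in blast)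
  moreover have "trans (\<theta> O \<phi>)"
  proof -
    have "(\<theta> O \<phi>) O (\<theta> O \<phi>) = \<theta> O (\<phi> O \<theta>) O \<phi>"
      by (simp only: O_assoc)
    \<comment> \<open>Swapping the two middle factors makes equal congruences adjacent, so that
      transitivity collapses each pair.\<close>
    also have "\<dots> = (\<theta> O \<theta>) O (\<phi> O \<phi>)"
      by (simp only: perm[symmetric] O_assoc)
    also have "\<dots> \<subseteq> \<theta> O \<phi>"
      using congruence_trans[OF \<theta>] congruence_trans[OF \<phi>] by blast
    finally show ?thesis
      by (meson relcompI subsetD transI)
  qed
  moreover have "\<theta> O \<phi> \<subseteq> carrier A \<times> carrier A"
    using congruence_carrier[OF \<theta>] congruence_carrier[OF \<phi>] by blast
  moreover have "(x, x) \<in> \<theta> O \<phi>" if "x \<in> carrier A" for x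
    using congruence_refl[OF \<theta> that] congruence_refl[OF \<phi> that] by (rule relcompI)
  ultimately have "equiv (carrier A) (\<theta> O \<phi>)"
    by (simp add: equiv_on_iff)
  moreover have "(x \<oplus>\<^bsub>A\<^esub> u, y \<oplus>\<^bsub>A\<^esub> v) \<in> \<theta> O \<phi>" "(x \<otimes>\<^bsub>A\<^esub> u, y \<otimes>\<^bsub>A\<^esub> v) \<in> \<theta> O \<phi>"
    if "(x, y) \<in> \<theta> O \<phi>" "(u, v) \<in> \<theta> O \<phi>" for x y u v
    using that by (auto intro: congruence_add[OF \<theta>] congruence_add[OF \<phi>]
        congruence_mult[OF \<theta>] congruence_mult[OF \<phi>])
  moreover have "(\<alpha>\<^bsub>A\<^esub> x, \<alpha>\<^bsub>A\<^esub> y) \<in> \<theta> O \<phi>" if "(x, y) \<in> \<theta> O \<phi>" for x y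
    using that by (auto intro: congruence_invol[OF \<theta>] congruence_invol[OF \<phi>])
  ultimately show ?thesis
    by (simp add: congruences_iff)
qed

section \<open>Mal'cev and majority conditions\<close>

lemma congruence_permutable_malcev:
  assumes "\<zero>\<^bsub>A\<^esub> \<in> carrier A" "\<one>\<^bsub>A\<^esub> \<in> carrier A"
    and malcev: "\<And>x y. x \<in> carrier A \<Longrightarrow> y \<in> carrier A \<Longrightarrow>
      ternary_operation A p x x y = y \<and> ternary_operation A p x y y = x"
  shows "congruence_permutable A"
proof -
  have "\<theta> O \<phi> \<subseteq> \<phi> O \<theta>" if \<theta>: "\<theta> \<in> congruences A" and \<phi>: "\<phi> \<in> congruences A" for \<theta> \<phi>
  proof (rule subrelI)
    fix a c assume "(a, c) \<in> \<theta> O \<phi>"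
    then obtain b where ab: "(a, b) \<in> \<theta>" and bc: "(b, c) \<in> \<phi>" by blast
    have car: "a \<in> carrier A" "b \<in> carrier A" "c \<in> carrier A"
      using congruence_carrier[OF \<theta> ab] congruence_carrier[OF \<phi> bc] by auto
    \<comment> \<open>The new intermediate element is \<open>p a b c\<close>: changing
      \<open>c\<close> to \<open>b\<close> turns it into \<open>a\<close>, and changing
      \<open>a\<close> to \<open>b\<close> turns it into \<open>c\<close>.\<close>
    have "(ternary_operation A p a b b, ternary_operation A p a b c) \<in> \<phi>"
      using assms(1,2) car bc by (intro congruence_ternary_operation[OF \<phi>] congruence_refl[OF \<phi>])
    moreover have "(ternary_operation A p a b c, ternary_operation A p b b c) \<in> \<theta>"
      using assms(1,2) car ab by (intro congruence_ternary_operation[OF \<theta>] congruence_refl[OF \<theta>])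
    ultimately show "(a, c) \<in> \<phi> O \<theta>"
      using malcev car by auto
  qed
  \<comment> \<open>The inclusion holds for every pair of congruences, so exchanging them gives
    equality.\<close>
  then show ?thesis
    unfolding congruence_permutable_def by blast
qed

text \<open>With \<open>m\<close> the majority operation, the element \<open>m a b c\<close>
  replaces \<open>b\<close>. Varying its middle argument links it to \<open>a\<close> by \<phi> and
  to \<open>c\<close> by \<psi>; varying an outer argument links it to both by \<theta>.\<close>

lemma congruence_Int_relcomp_majority:
  assumes "\<zero>\<^bsub>A\<^esub> \<in> carrier A" "\<one>\<^bsub>A\<^esub> \<in> carrier A"
    and majority: "\<And>x y. x \<in> carrier A \<Longrightarrow> y \<in> carrier A \<Longrightarrow>
      ternary_operation A p x x y = x \<and> ternary_operation A p x y x = x \<and>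
      ternary_operation A p y x x = x"
    and \<theta>: "\<theta> \<in> congruences A" and \<phi>: "\<phi> \<in> congruences A" and \<psi>: "\<psi> \<in> congruences A"
  shows "\<theta> \<inter> (\<phi> O \<psi>) \<subseteq> (\<theta> \<inter> \<phi>) O (\<theta> \<inter> \<psi>)"
proof (rule subrelI)
  fix a c assume "(a, c) \<in> \<theta> \<inter> (\<phi> O \<psi>)"
  then obtain b where ac: "(a, c) \<in> \<theta>" and ab: "(a, b) \<in> \<phi>" and bc: "(b, c) \<in> \<psi>" by blast
  have car: "a \<in> carrier A" "b \<in> carrier A" "c \<in> carrier A"
    using congruence_carrier[OF \<phi> ab] congruence_carrier[OF \<psi> bc] by auto
  let ?m = "ternary_operation A p"
  have "(?m a a c, ?m a b c) \<in> \<phi>"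
    using assms(1,2) car ab by (intro congruence_ternary_operation[OF \<phi>] congruence_refl[OF \<phi>])
  moreover have "(?m a b a, ?m a b c) \<in> \<theta>" "(?m a b c, ?m c b c) \<in> \<theta>"
    using assms(1,2) car ac by (auto intro!: congruence_ternary_operation[OF \<theta>] congruence_refl[OF \<theta>])
  moreover have "(?m a b c, ?m a c c) \<in> \<psi>"
    using assms(1,2) car bc by (intro congruence_ternary_operation[OF \<psi>] congruence_refl[OF \<psi>])
  ultimately show "(a, c) \<in> (\<theta> \<inter> \<phi>) O (\<theta> \<inter> \<psi>)"
    using majority car by auto
qed

section \<open>The lattice of congruences\<close>

lemma congruence_lattice_sel [simp]:
  "carrier (congruence_lattice A) = congruences A"
  "x \<sqsubseteq>\<^bsub>congruence_lattice A\<^esub> y \<longleftrightarrow> x \<subseteq> y"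
  "x .=\<^bsub>congruence_lattice A\<^esub> y \<longleftrightarrow> x = y"
  by (simp_all add: congruence_lattice_def)

lemma congruence_lattice_partial_order: "partial_order (congruence_lattice A)"
  by unfold_locales (auto simp: congruence_lattice_def)

lemma congruence_lattice_greatest:
  assumes "\<theta> \<in> congruences A" "\<phi> \<in> congruences A"
  shows "greatest (congruence_lattice A) (\<theta> \<inter> \<phi>) (Lower (congruence_lattice A) {\<theta>, \<phi>})"
  using assms congruences_Int[OF assms] by (auto simp: greatest_def Lower_def)

text \<open>Reflexivity embeds both congruences in the composite, and transitivity of any common
  upper bound absorbs the composite.\<close>

lemma congruence_lattice_least:
  assumes \<theta>: "\<theta> \<in> congruences A" and \<phi>: "\<phi> \<in> congruences A" and perm: "\<theta> O \<phi> = \<phi> O \<theta>"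
  shows "least (congruence_lattice A) (\<theta> O \<phi>) (Upper (congruence_lattice A) {\<theta>, \<phi>})"
proof -
  have "\<theta> \<subseteq> \<theta> O \<phi>" "\<phi> \<subseteq> \<theta> O \<phi>"
    using congruence_carrier[OF \<theta>] congruence_carrier[OF \<phi>]
      congruence_refl[OF \<theta>] congruence_refl[OF \<phi>] by (meson relcompI subrelI)+
  moreover have "\<theta> O \<phi> \<subseteq> \<psi>" if "\<psi> \<in> congruences A" "\<theta> \<subseteq> \<psi>" "\<phi> \<subseteq> \<psi>" for \<psi>
    using that congruence_trans[OF that(1)] by blast
  ultimately show ?thesis
    using assms congruences_relcomp[OF assms] by (auto simp: least_def Upper_def)
qed

text \<open>Permutability turns joins into composites, so that distributivity becomes the relational
  inclusion obtained from the majority term.\<close>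

lemma congruence_distributive_majority:
  assumes perm: "congruence_permutable A"
    and "\<zero>\<^bsub>A\<^esub> \<in> carrier A" "\<one>\<^bsub>A\<^esub> \<in> carrier A"
    and "\<And>x y. x \<in> carrier A \<Longrightarrow> y \<in> carrier A \<Longrightarrow>
      ternary_operation A p x x y = x \<and> ternary_operation A p x y x = x \<and>
      ternary_operation A p y x x = x"
  shows "congruence_distributive A"
proof -
  let ?L = "congruence_lattice A"
  interpret po: partial_order ?L
    by (rule congruence_lattice_partial_order)
  have perm: "\<theta> O \<phi> = \<phi> O \<theta>" if "\<theta> \<in> congruences A" "\<phi> \<in> congruences A" for \<theta> \<phi>
    using perm that by (simp add: congruence_permutable_def)
  interpret lat: Lattice.lattice ?L
  proof unfold_locales
    fix \<theta> \<phi> assume "\<theta> \<in> carrier ?L" "\<phi> \<in> carrier ?L"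
    then have *: "\<theta> \<in> congruences A" "\<phi> \<in> congruences A" by simp_all
    from congruence_lattice_least[OF * perm[OF *]]
    show "\<exists>s. least ?L s (Upper ?L {\<theta>, \<phi>})" ..
    from congruence_lattice_greatest[OF *]
    show "\<exists>s. greatest ?L s (Lower ?L {\<theta>, \<phi>})" ..
  qed
  \<comment> \<open>Meet and join are defined by choice; uniqueness of bounds identifies them with
    the concrete relations.\<close>
  have meet: "\<theta> \<sqinter>\<^bsub>?L\<^esub> \<phi> = \<theta> \<inter> \<phi>" if "\<theta> \<in> congruences A" "\<phi> \<in> congruences A" for \<theta> \<phi>
    using po.greatest_unique[OF lat.inf_of_two_greatest congruence_lattice_greatest[OF that]] that
    by (simp add: meet_def)
  have join: "\<theta> \<squnion>\<^bsub>?L\<^esub> \<phi> = \<theta> O \<phi>" if "\<theta> \<in> congruences A" "\<phi> \<in> congruences A" for \<theta> \<phi>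
    using po.least_unique[OF lat.sup_of_two_least congruence_lattice_least[OF that perm[OF that]]] that
    by (simp add: join_def)
  \<comment> \<open>The inclusion from right to left is transitivity of \<theta>.\<close>
  have "\<theta> \<inter> (\<phi> O \<psi>) = (\<theta> \<inter> \<phi>) O (\<theta> \<inter> \<psi>)"
    if "\<theta> \<in> congruences A" "\<phi> \<in> congruences A" "\<psi> \<in> congruences A" for \<theta> \<phi> \<psi>
    using congruence_Int_relcomp_majority[OF assms(2-4) that] congruence_trans[OF that(1)] by blast
  then show ?thesis
    unfolding congruence_distributive_def
    by unfold_locales (simp add: meet join congruences_Int congruences_relcomp perm)
qed

section \<open>The median as a majority term in involutive near semirings\<close>

definition meet_trm :: "'v trm \<Rightarrow> 'v trm \<Rightarrow> 'v trm" where
  "meet_trm t u = Invol (Plus (Invol t) (Invol u))"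

definition median_trm :: "var3 trm" where
  "median_trm = Plus (Plus (meet_trm (Var X) (Var Y)) (meet_trm (Var Y) (Var Z)))
     (meet_trm (Var X) (Var Z))"

context involutive_near_semiring
begin

lemma induced_le_iff: "induced_le R x y \<longleftrightarrow> x \<oplus> y = y"
  by (simp add: induced_le_def)

text \<open>The second summand is the De Morgan meet of \<open>x\<close> and \<open>y\<close>. By
  idempotency \<open>\<alpha> x\<close> lies below \<open>\<alpha> x \<oplus> \<alpha> y\<close>,
  and the antitone \<alpha> reverses this.\<close>

lemma meet_absorb:
  assumes "x \<in> carrier R" "y \<in> carrier R"
  shows "x \<oplus> \<alpha> (\<alpha> x \<oplus> \<alpha> y) = x"
proof -
  have "induced_le R (\<alpha> x) (\<alpha> x \<oplus> \<alpha> y)"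
    using assms a_assoc[of "\<alpha> x" "\<alpha> x" "\<alpha> y"]
    by (simp only: induced_le_iff invol_closed add_idem)
  then have "induced_le R (\<alpha> (\<alpha> x \<oplus> \<alpha> y)) x"
    using assms invol_antimono[of "\<alpha> x" "\<alpha> x \<oplus> \<alpha> y"] by (simp add: invol_closed invol_invol)
  then show ?thesis
    using assms by (simp add: induced_le_iff invol_closed a_comm)
qed

text \<open>When two arguments equal \<open>x\<close>, one of the three meets is \<open>x\<close>
  itself, and it absorbs the other two, both being the meet of \<open>x\<close> and
  \<open>y\<close>.\<close>

lemma median_majority:
  assumes "x \<in> carrier R" "y \<in> carrier R"
  shows "ternary_operation R median_trm x x y = x"
    and "ternary_operation R median_trm x y x = x"
    and "ternary_operation R median_trm y x x = x"
proof -
  \<comment> \<open>Depending on the argument pattern, the meet stands to the left of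
    \<open>x\<close> or has its arguments swapped.\<close>
  have "\<alpha> (\<alpha> x \<oplus> \<alpha> y) \<oplus> x = x" "\<alpha> y \<oplus> \<alpha> x = \<alpha> x \<oplus> \<alpha> y"
    using assms meet_absorb[OF assms] by (simp_all add: invol_closed a_comm)
  then show "ternary_operation R median_trm x x y = x"
    and "ternary_operation R median_trm x y x = x"
    and "ternary_operation R median_trm y x x = x"
    using assms meet_absorb[OF assms]
    by (simp_all add: ternary_operation_def median_trm_def meet_trm_def add_idem invol_closed
        invol_invol)
qed

end

section \<open>Consequences of the Lukasiewicz identity\<close>

context lukasiewicz_near_semiring
begin

lemma invol_one: "\<alpha> \<one> = \<zero>"
proof -
  \<comment> \<open>The right side of this instance is
    \<open>\<alpha> (\<alpha> \<zero>) \<otimes> \<alpha> \<zero>\<close>, a product with left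
    factor \<open>\<zero>\<close>.\<close>
  have "\<alpha> \<zero> \<otimes> \<alpha> \<one> = \<zero>"
    using lukasiewicz[of \<zero> \<one>] by (simp add: l_null l_one one_closed invol_closed invol_invol)
  moreover have "\<one> \<oplus> \<alpha> \<zero> = \<alpha> \<zero>"
    using invol_antimono[of \<zero> "\<alpha> \<one>"]
    by (simp add: induced_le_iff one_closed invol_closed invol_invol)
  \<comment> \<open>Multiply \<open>\<one> \<oplus> \<alpha> \<zero> = \<alpha> \<zero>\<close> on
    the right by \<open>\<alpha> \<one>\<close>.\<close>
  ultimately have "\<alpha> \<one> \<oplus> \<zero> = \<zero>"
    using l_distr[of \<one> "\<alpha> \<zero>" "\<alpha> \<one>"] by (metis l_one one_closed invol_closed zero_closed)
  then show ?thesis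
    by (simp add: one_closed invol_closed)
qed

lemma invol_zero: "\<alpha> \<zero> = \<one>"
  using invol_one invol_invol[OF one_closed] by simp

text \<open>Dual under \<alpha> to \<open>\<zero>\<close> being the least element.\<close>

lemma add_one: "x \<in> carrier R \<Longrightarrow> x \<oplus> \<one> = \<one>"
  using invol_antimono[of \<zero> "\<alpha> x"]
  by (simp add: induced_le_iff invol_closed invol_invol invol_zero)

text \<open>With \<open>\<one>\<close> as second argument, the left side of the identity has the
  right factor \<open>\<alpha> \<one> = \<zero>\<close>.\<close>

lemma mult_invol_self: "x \<in> carrier R \<Longrightarrow> x \<otimes> \<alpha> x = \<zero>"
  using lukasiewicz[of x \<one>]
  by (simp add: one_closed invol_one r_null l_one invol_closed invol_invol)

text \<open>Multiply \<open>x \<oplus> \<one> = \<one>\<close> on the right by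
  \<open>y\<close>.\<close>

lemma mult_add_absorb: "x \<in> carrier R \<Longrightarrow> y \<in> carrier R \<Longrightarrow> x \<otimes> y \<oplus> y = y"
  using l_distr[of x \<one> y] by (simp add: one_closed l_one add_one)

text \<open>Since \<open>u \<otimes> \<alpha> u = \<zero>\<close> and
  \<open>\<alpha> \<zero> = \<one>\<close>, one summand under the outer \<alpha> collapses to
  \<open>\<alpha> y\<close> or \<open>\<alpha> x\<close> respectively; the other summand lies below
  it.\<close>

lemma malcev_equations:
  assumes "x \<in> carrier R" "y \<in> carrier R"
  shows "ternary_operation R lukasiewicz_malcev x x y = y"
    and "ternary_operation R lukasiewicz_malcev x y y = x"
proof -
  \<comment> \<open>The Lukasiewicz identity rewrites the product so that its right factor is
    \<open>\<alpha> x\<close> instead of \<open>\<alpha> y\<close>; each form yields one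
    bound.\<close>
  have le: "\<alpha> (x \<otimes> \<alpha> y) \<otimes> \<alpha> y \<oplus> \<alpha> y = \<alpha> y" "\<alpha> (x \<otimes> \<alpha> y) \<otimes> \<alpha> y \<oplus> \<alpha> x = \<alpha> x"
    using assms mult_add_absorb[of "\<alpha> (x \<otimes> \<alpha> y)" "\<alpha> y"]
      mult_add_absorb[of "\<alpha> (y \<otimes> \<alpha> x)" "\<alpha> x"] lukasiewicz[OF assms]
    by (simp_all add: m_closed invol_closed)
  have "\<alpha> y \<oplus> \<alpha> (y \<otimes> \<alpha> x) \<otimes> \<alpha> x = \<alpha> y"
    using assms le(1) lukasiewicz[OF assms] by (simp add: a_comm m_closed invol_closed)
  then show "ternary_operation R lukasiewicz_malcev x x y = y"
    using assms by (simp add: ternary_operation_lukasiewicz_malcev mult_invol_self invol_zero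
        l_one invol_closed invol_invol)
  show "ternary_operation R lukasiewicz_malcev x y y = x"
    using assms le(2) by (simp add: ternary_operation_lukasiewicz_malcev mult_invol_self invol_zero
        l_one invol_closed invol_invol)
qed

lemma arithmetical: "arithmetical R"
proof -
  have "congruence_permutable R"
    by (rule congruence_permutable_malcev[where p = lukasiewicz_malcev, OF zero_closed one_closed])
      (simp add: malcev_equations)
  moreover from this have "congruence_distributive R"
    by (rule congruence_distributive_majority[where p = median_trm, OF _ zero_closed one_closed])
      (simp add: median_majority)
  ultimately show ?thesis
    by (simp add: arithmetical_def)
qed

end

theorem theorem8:
  shows "arithmetical_class (lukasiewicz_near_semiring :: 'a involutive_algebra \<Rightarrow> bool)
    \<and> malcev_term (lukasiewicz_near_semiring :: 'a involutive_algebra \<Rightarrow> bool) lukasiewicz_malcev"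
  by (simp add: arithmetical_class_def malcev_term_def lukasiewicz_near_semiring.arithmetical
      lukasiewicz_near_semiring.malcev_equations)

end
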